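(* Let $T$ be a closed symmetric linear relation in a Krein space $\mathfrak H$, let $(\mathfrak L,\Gamma)$ be an isometric boundary pair for $T^+$, and let $M_{\overline\Gamma}$ be the Weyl family corresponding to the isometric boundary pair $(\mathfrak L,\overline\Gamma)$ for $T^+$. Put $A_\star:=\operatorname{dom}\overline\Gamma$ and $A_\#:=\operatorname{dom}\Gamma_\#$. Then $$M_{\overline\Gamma}(z)^*=M_{\Gamma_\#}(\overline z)$$ for all $z\in\mathbb C_*$ such that $\operatorname{ran}(A_\star-zI)$ is a subspace; if also $\operatorname{ran}(A_\#-\overline zI)$ is a subspace, then $M_{\overline\Gamma}(z)$ is a closed relation in $\mathfrak L$.
   Context: Linear relations: a relation from a linear space $X$ to a linear space $Y$ is a linear subset $R\subseteq X\times Y$ (a relation in $X$ if $X=Y$); operators are identified with their graphs. $\operatorname{dom}R,\operatorname{ran}R$ are the domain and range, $\ker R=\{x:(x,0)\in R\}$, $\operatorname{mul}R=\{y:(0,y)\in R\}$, $R^{-1}=\{(y,x):(x,y)\in R\}$, $R(S)=\{y:\exists x\in S,\ (x,y)\in R\}$, $\overline R$ is the closure. A subspace is a closed linear subset. For a relation $R$ in $\mathfrak H$, $R-zI=\{(f,f'-zf):(f,f')\in R\}$, and $zI=\{(f,zf):f\in\mathfrak H\}$. $\mathbb C_*=\mathbb C\setminus\mathbb R$. Krein space: a Hilbert space $(\mathfrak H,\langle\cdot,\cdot\rangle)$ with a fundamental symmetry $J=J^*=J^{-1}$ and indefinite metric $[f,g]=\langle f,Jg\rangle$. The adjoint of a relation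 $T$ in $\mathfrak H$ is $T^+=\{(g,g')\in\mathfrak H^2:[f',g]=[f,g']\ \forall(f,f')\in T\}$; $T$ is symmetric if $T\subseteq T^+$. For a relation in a Hilbert space, $^*$ denotes the Hilbert space adjoint. Boundary pairs: $\mathfrak L$ is a Hilbert space; $\mathfrak H^2$ and $\mathfrak L^2$ carry the fundamental symmetries $\widehat J_{\mathfrak H}=\begin{pmatrix}0&-iJ\\ iJ&0\end{pmatrix}$ and $\widehat J^\circ_{\mathfrak L}=\begin{pmatrix}0&-iI\\ iI&0\end{pmatrix}$. For a relation $\Gamma\subseteq\mathfrak H^2\times\mathfrak L^2$ put $\Gamma^+=\widehat J_{\mathfrak H}\Gamma^*\widehat J^\circ_{\mathfrak L}$, with $\Gamma^*$ the Hilbert space adjoint, and $\Gamma_\#=(\Gamma^+)^{-1}\subseteq\mathfrak H^2\times\mathfrak L^2$. $\Gamma$ is isometric if $\Gamma\subseteq\Gamma_\#$. For a closed symmetric relation $T$, $(\mathfrak L,\Gamma)$ is an isometric boundary pair for $T^+$ if $\Gamma$ is isometric and $T=\ker\Gamma_\#$. Then $(\mathfrak L,\overline\Gamma)$ is also an isometric boundary pair for $T^+$. For any relation $\Gamma\subseteq\mathfrak H^2\times\mathfrak L^2$ put $M_\Gamma(z)=\Gamma(zI)=\{\widehat l\in\mathfrak L^2:\exists f\in\mathfrak H,\ ((f,zf),\widehat l)\in\Gamma\}$ for $z\in\mathbb C_*$, a relation in $\mathfrak L$. If $(\mathfrak L,\Gamma)$ is an isometric boundary pair this is its Weyl family; $M_{\overline\Gamma}$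 and $M_{\Gamma_\#}$ are defined by the same formula with $\overline\Gamma$, $\Gamma_\#$. *)

theory Defs
  imports "HOL-Analysis.Analysis"
begin

section \<open>Complex Hilbert spaces\<close>

class scaleC =
  fixes scaleC :: "complex \<Rightarrow> 'a \<Rightarrow> 'a" (infixr \<open>*\<^sub>C\<close> 75)

class complex_vector = scaleC + real_vector +
  assumes scaleC_add_right: "a *\<^sub>C (x + y) = a *\<^sub>C x + a *\<^sub>C y"
    and scaleC_add_left: "(a + b) *\<^sub>C x = a *\<^sub>C x + b *\<^sub>C x"
    and scaleC_scaleC: "a *\<^sub>C (b *\<^sub>C x) = (a * b) *\<^sub>C x"
    and scaleC_one: "1 *\<^sub>C x = x"
    and scaleR_scaleC: "r *\<^sub>R x = complex_of_real r *\<^sub>C x"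

interpretation complex_vector: vector_space "scaleC :: complex \<Rightarrow> 'a \<Rightarrow> 'a::complex_vector"
  by unfold_locales (simp_all add: scaleC_add_right scaleC_add_left scaleC_scaleC scaleC_one)

text \<open>The complex inner product is linear in its first and conjugate-linear in its second
  argument. Positive definiteness and the topology come from the underlying real inner product
  space: \<open>cinner x x\<close> is real by conjugate symmetry and has real part \<open>inner x x\<close>, the
  square of the norm.\<close>

class complex_inner = complex_vector + real_inner +
  fixes cinner :: "'a \<Rightarrow> 'a \<Rightarrow> complex"
  assumes cinner_commute: "cinner x y = cnj (cinner y x)"
    and cinner_add_left: "cinner (x + y) z = cinner x z + cinner y z"
    and cinner_scaleC_left: "cinner (a *\<^sub>C x) y = a * cinner x y"
    and inner_eq_Re_cinner: "inner x y = Re (cinner x y)"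

class complex_hilbert_space = complex_inner + complete_space

instantiation complex :: complex_hilbert_space
begin

definition scaleC_complex :: "complex \<Rightarrow> complex \<Rightarrow> complex"
  where "scaleC_complex a x = a * x"

definition cinner_complex :: "complex \<Rightarrow> complex \<Rightarrow> complex"
  where "cinner_complex x y = x * cnj y"

instance
  by standard (simp_all add: scaleC_complex_def cinner_complex_def algebra_simps
      scaleR_conv_of_real inner_complex_def)

end

instantiation prod :: (complex_vector, complex_vector) complex_vector
begin

definition scaleC_prod :: "complex \<Rightarrow> 'a \<times> 'b \<Rightarrow> 'a \<times> 'b"
  where "scaleC_prod a p = (a *\<^sub>C fst p, a *\<^sub>C snd p)"

instance
  by standard (simp_all add: scaleC_prod_def prod_eq_iff scaleC_add_right scaleC_add_left
      scaleC_scaleC scaleC_one scaleR_scaleC)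

end

instantiation prod :: (complex_inner, complex_inner) complex_inner
begin

definition cinner_prod :: "'a \<times> 'b \<Rightarrow> 'a \<times> 'b \<Rightarrow> complex"
  where "cinner_prod p q = cinner (fst p) (fst q) + cinner (snd p) (snd q)"

instance
proof
  fix x y z :: "'a \<times> 'b" and a :: complex
  show "cinner x y = cnj (cinner y x)"
    unfolding cinner_prod_def complex_cnj_add
    by (metis cinner_commute)
  show "cinner (x + y) z = cinner x z + cinner y z"
    by (simp add: cinner_prod_def cinner_add_left)
  show "cinner (a *\<^sub>C x) y = a * cinner x y"
    by (simp add: cinner_prod_def scaleC_prod_def cinner_scaleC_left algebra_simps)
  show "inner x y = Re (cinner x y)"
    by (simp add: cinner_prod_def inner_prod_def inner_eq_Re_cinner)
qed

end

instance prod :: (complex_hilbert_space, complex_hilbert_space) complex_hilbert_space ..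

section \<open>Linear relations\<close>

text \<open>Linear relations are sets of pairs that are complex linear subsets of the product space;
  domain, range, inverse and image are \<open>Domain\<close>, \<open>Range\<close>, \<open>converse\<close> and \<open>Image\<close>.\<close>

abbreviation linear_relation :: "('a::complex_vector \<times> 'b::complex_vector) set \<Rightarrow> bool"
  where "linear_relation R \<equiv> complex_vector.subspace R"

definition closed_csubspace :: "'a::complex_inner set \<Rightarrow> bool"
  where "closed_csubspace S \<longleftrightarrow> complex_vector.subspace S \<and> closed S"

definition rel_ker :: "('a \<times> 'b::zero) set \<Rightarrow> 'a set"
  where "rel_ker R = {x. (x, 0) \<in> R}"

definition graph_of :: "('a \<Rightarrow> 'b) \<Rightarrow> ('a \<times> 'b) set"
  where "graph_of F = {(x, F x) | x. True}"

definition rel_scalar :: "complex \<Rightarrow> ('a::complex_vector \<times> 'a) set"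
  where "rel_scalar z = graph_of (\<lambda>f. z *\<^sub>C f)"

definition rel_shift :: "('a::complex_vector \<times> 'a) set \<Rightarrow> complex \<Rightarrow> ('a \<times> 'a) set"
  where "rel_shift R z = {(f, f' - z *\<^sub>C f) | f f'. (f, f') \<in> R}"

definition hilbert_adjoint ::
    "('a::complex_inner \<times> 'b::complex_inner) set \<Rightarrow> ('b \<times> 'a) set"
  where "hilbert_adjoint R = {(y, x). \<forall>(u, v)\<in>R. cinner v y = cinner u x}"

section \<open>Krein spaces\<close>

text \<open>The condition \<open>J = J\<^sup>* = J\<inverse>\<close>, with operators read as graphs. Linearity of \<open>J\<close> need not be
  required separately, since a Hilbert space adjoint is always a linear relation.\<close>

definition fundamental_symmetry :: "('h::complex_inner \<Rightarrow> 'h) \<Rightarrow> bool"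
  where "fundamental_symmetry J \<longleftrightarrow>
    graph_of J = hilbert_adjoint (graph_of J) \<and> graph_of J = (graph_of J)\<inverse>"

definition krein_inner :: "('h::complex_inner \<Rightarrow> 'h) \<Rightarrow> 'h \<Rightarrow> 'h \<Rightarrow> complex"
  where "krein_inner J f g = cinner f (J g)"

definition krein_adjoint :: "('h::complex_inner \<Rightarrow> 'h) \<Rightarrow> ('h \<times> 'h) set \<Rightarrow> ('h \<times> 'h) set"
  where "krein_adjoint J T =
    {(g, g'). \<forall>(f, f')\<in>T. krein_inner J f' g = krein_inner J f g'}"

definition krein_symmetric :: "('h::complex_inner \<Rightarrow> 'h) \<Rightarrow> ('h \<times> 'h) set \<Rightarrow> bool"
  where "krein_symmetric J T \<longleftrightarrow> T \<subseteq> krein_adjoint J T"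

section \<open>Boundary pairs\<close>

text \<open>The block operator with rows \<open>(0, -iJ)\<close> and \<open>(iJ, 0)\<close>; on the square of the boundary
  space it is used with \<open>J = id\<close>.\<close>

definition Jhat :: "('h::complex_inner \<Rightarrow> 'h) \<Rightarrow> 'h \<times> 'h \<Rightarrow> 'h \<times> 'h"
  where "Jhat J = (\<lambda>(f, f'). ((- \<i>) *\<^sub>C J f', \<i> *\<^sub>C J f))"

text \<open>Relational composition \<open>O\<close> is written in the order of application, i.e. reversed with
  respect to the operator product \<open>Jhat J \<cdot> \<Gamma>\<^sup>* \<cdot> Jhat id\<close>.\<close>

definition boundary_adjoint ::
    "('h::complex_inner \<Rightarrow> 'h) \<Rightarrow> (('h \<times> 'h) \<times> ('l::complex_inner \<times> 'l)) set \<Rightarrow>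
      (('l \<times> 'l) \<times> ('h \<times> 'h)) set"
  where "boundary_adjoint J \<Gamma> = graph_of (Jhat id) O hilbert_adjoint \<Gamma> O graph_of (Jhat J)"

definition boundary_sharp ::
    "('h::complex_inner \<Rightarrow> 'h) \<Rightarrow> (('h \<times> 'h) \<times> ('l::complex_inner \<times> 'l)) set \<Rightarrow>
      (('h \<times> 'h) \<times> ('l \<times> 'l)) set"
  where "boundary_sharp J \<Gamma> = (boundary_adjoint J \<Gamma>)\<inverse>"

definition isometric_relation ::
    "('h::complex_inner \<Rightarrow> 'h) \<Rightarrow> (('h \<times> 'h) \<times> ('l::complex_inner \<times> 'l)) set \<Rightarrow> bool"
  where "isometric_relation J \<Gamma> \<longleftrightarrow> linear_relation \<Gamma> \<and> \<Gamma> \<subseteq> boundary_sharp J \<Gamma>"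

text \<open>\<open>isometric_boundary_pair J T \<Gamma>\<close>: the pair of the Hilbert space \<open>'l\<close> and \<open>\<Gamma>\<close> is an isometric
  boundary pair for \<open>krein_adjoint J T\<close>, where \<open>T\<close> is a closed symmetric relation.\<close>

definition isometric_boundary_pair ::
    "('h::complex_inner \<Rightarrow> 'h) \<Rightarrow> ('h \<times> 'h) set \<Rightarrow>
      (('h \<times> 'h) \<times> ('l::complex_inner \<times> 'l)) set \<Rightarrow> bool"
  where "isometric_boundary_pair J T \<Gamma> \<longleftrightarrow>
    isometric_relation J \<Gamma> \<and> T = rel_ker (boundary_sharp J \<Gamma>)"

definition weyl_family ::
    "(('h::complex_vector \<times> 'h) \<times> ('l \<times> 'l)) set \<Rightarrow> complex \<Rightarrow> ('l \<times> 'l) set"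
  where "weyl_family \<Gamma> z = \<Gamma> `` rel_scalar z"

end

theory Submission
  imports Defs
begin

text \<open>Write \<open>A\<close> for the map \<open>((f, f'), (h, h')) \<mapsto> f' - z f\<close> on the closure of \<open>\<Gamma>\<close>; its range is
  \<open>ran (A\<^sub>\<star> - z I)\<close>. A pair \<open>(m, m')\<close> lies in the adjoint of the Weyl family exactly when the
  functional \<open>((f, f'), (h, h')) \<mapsto> \<langle>h', m\<rangle> - \<langle>h, m'\<rangle>\<close> vanishes on the kernel of \<open>A\<close>. If \<open>A\<close> has
  closed range, the open mapping theorem shows that this functional factors through \<open>A\<close> by a
  bounded functional, and its Riesz vector is \<open>J g\<close> with
  \<open>((g, cnj z g), (m, m')) \<in> \<Gamma>\<^sub>#\<close>. The second claim is the first one applied to \<open>\<Gamma>\<^sub>#\<close>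
  at \<open>cnj z\<close>, since \<open>\<Gamma>\<^sub>#\<^sub>#\<close> is the closure of \<open>\<Gamma>\<close> and adjoints are closed.\<close>

section \<open>Complex inner products\<close>

lemma cinner_add_right: "cinner x (y + z) = cinner x y + cinner x z"
  for x :: "'a::complex_inner"
  by (metis cinner_add_left cinner_commute complex_cnj_add)

lemma cinner_scaleC_right: "cinner x (a *\<^sub>C y) = cnj a * cinner x y"
  for x :: "'a::complex_inner"
  by (metis cinner_commute cinner_scaleC_left complex_cnj_mult)

lemma cinner_zero_left [simp]: "cinner 0 x = 0" for x :: "'a::complex_inner"
  using cinner_add_left[of 0 0 x] by simp

lemma cinner_zero_right [simp]: "cinner x 0 = 0" for x :: "'a::complex_inner"
  using cinner_add_right[of x 0 0] by simp

lemma cinner_diff_left: "cinner (x - y) z = cinner x z - cinner y z" for x :: "'a::complex_inner"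
  using cinner_add_left[of "x - y" y z] by simp

lemma cinner_diff_right: "cinner x (y - z) = cinner x y - cinner x z" for x :: "'a::complex_inner"
  using cinner_add_right[of x "y - z" z] by simp

lemma cinner_minus_left: "cinner (- x) y = - cinner x y" for x :: "'a::complex_inner"
  using cinner_diff_left[of 0 x y] by simp

lemma cinner_minus_right: "cinner x (- y) = - cinner x y" for x :: "'a::complex_inner"
  using cinner_diff_right[of x 0 y] by simp

lemma cinner_Pair_left: "cinner (a, b) q = cinner a (fst q) + cinner b (snd q)"
  by (simp add: cinner_prod_def)

lemma cinner_Pair_right: "cinner p (a, b) = cinner (fst p) a + cinner (snd p) b"
  by (simp add: cinner_prod_def)

lemma cinner_self: "cinner x x = complex_of_real ((norm x)\<^sup>2)" for x :: "'a::complex_inner"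
proof (rule complex_eqI)
  show "Im (cinner x x) = Im (complex_of_real ((norm x)\<^sup>2))"
    using cinner_commute[of x x] by (simp add: complex_eq_iff)
qed (simp add: power2_norm_eq_inner inner_eq_Re_cinner)

text \<open>The norm belongs to the real structure, so homogeneity under complex scalars has to be
  read off from \<open>cinner_self\<close>.\<close>

lemma norm_scaleC: "norm (a *\<^sub>C x) = cmod a * norm x" for x :: "'a::complex_inner"
proof -
  have "complex_of_real ((norm (a *\<^sub>C x))\<^sup>2) = a * cnj a * complex_of_real ((norm x)\<^sup>2)"
    by (simp add: cinner_self[symmetric] cinner_scaleC_left cinner_scaleC_right del: of_real_power)
  also have "\<dots> = complex_of_real ((cmod a * norm x)\<^sup>2)"
    by (simp add: complex_norm_square[symmetric] power_mult_distrib)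
  finally have "(norm (a *\<^sub>C x))\<^sup>2 = (cmod a * norm x)\<^sup>2"
    using of_real_eq_iff by blast
  then show ?thesis by simp
qed

lemma bounded_linear_scaleC: "bounded_linear (\<lambda>x::'a::complex_inner. a *\<^sub>C x)"
  by (rule bounded_linear_intro[of _ "cmod a"])
    (simp_all add: scaleC_add_right scaleR_scaleC scaleC_scaleC norm_scaleC mult.commute)

text \<open>Since \<open>cinner x (\<i> *\<^sub>C y) = - \<i> * cinner x y\<close>, the real inner
  product with the rotated vector recovers the imaginary part; boundedness of \<open>cinner\<close>
  thus reduces to that of \<open>inner\<close>.\<close>

lemma cinner_eq_Complex: "cinner x y = Complex (inner x y) (inner x (\<i> *\<^sub>C y))"
  for x :: "'a::complex_inner"
  by (simp add: complex_eq_iff inner_eq_Re_cinner cinner_scaleC_right)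

lemma bounded_linear_cinner_left: "bounded_linear (\<lambda>x::'a::complex_inner. cinner x y)"
proof -
  have "bounded_linear (\<lambda>x. complex_of_real (inner x y) + \<i> * complex_of_real (inner x (\<i> *\<^sub>C y)))"
    by (intro bounded_linear_add bounded_linear_const_mult
        bounded_linear_compose[OF bounded_linear_of_real] bounded_linear_inner_left)
  then show ?thesis
    by (simp add: cinner_eq_Complex Complex_eq)
qed

lemma continuous_on_cinner_left: "continuous_on S (\<lambda>x::'a::complex_inner. cinner x y)"
  by (rule linear_continuous_on[OF bounded_linear_cinner_left])

lemma continuous_on_cinner_right: "continuous_on S (\<lambda>x::'a::complex_inner. cinner y x)"
proof -
  have "continuous_on S (\<lambda>x. cnj (cinner x y))"
    by (intro continuous_on_cnj continuous_on_cinner_left)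
  then show ?thesis by (simp flip: cinner_commute)
qed

section \<open>Complex subspaces and their closures\<close>

lemma csubspace_imp_subspace: "complex_vector.subspace S \<Longrightarrow> subspace S"
  by (simp add: complex_vector.subspace_def subspace_def scaleR_scaleC)

lemma csubspace_closure:
  fixes S :: "'a::complex_inner set"
  assumes "complex_vector.subspace S"
  shows "complex_vector.subspace (closure S)"
proof -
  have "x + y \<in> closure S" if xy: "x \<in> closure S" "y \<in> closure S" for x y
  proof -
    obtain u v where "\<And>n. u n \<in> S" "u \<longlonglongrightarrow> x" "\<And>n. v n \<in> S" "v \<longlonglongrightarrow> y"
      using xy unfolding closure_sequential by blast
    moreover from this have "\<And>n. u n + v n \<in> S"
      using assms by (simp add: complex_vector.subspace_def)
    ultimately show ?thesis
      unfolding closure_sequential by (intro exI[of _ "\<lambda>n. u n + v n"]) (auto intro: tendsto_add)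
  qed
  moreover have "(\<lambda>x. a *\<^sub>C x) ` closure S \<subseteq> closure S" for a
  proof (rule image_closure_subset)
    show "continuous_on (closure S) (\<lambda>x. a *\<^sub>C x)"
      by (rule linear_continuous_on[OF bounded_linear_scaleC])
    show "(\<lambda>x. a *\<^sub>C x) ` S \<subseteq> closure S"
      using assms closure_subset by (fastforce simp: complex_vector.subspace_def)
  qed auto
  moreover have "0 \<in> closure S"
    using assms closure_subset by (auto simp: complex_vector.subspace_def)
  ultimately show ?thesis
    unfolding complex_vector.subspace_def by (meson image_subset_iff)
qed

section \<open>Orthogonal projection and bounded functionals\<close>

text \<open>A minimizing sequence for the distance to \<open>S\<close> is Cauchy by the
  parallelogram law; its limit is a nearest point, and the first variation at it gives
  orthogonality.\<close>

lemma orthogonal_projection_exists: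
  fixes x :: "'a::{real_inner, complete_space}"
  assumes S: "subspace S" "closed S"
  obtains p where "p \<in> S" "\<And>s. s \<in> S \<Longrightarrow> inner s (x - p) = 0"
proof -
  define d where "d = infdist x S"
  have ne: "S \<noteq> {}" and d0: "0 \<le> d"
    using subspace_0[OF S(1)] by (auto simp: d_def infdist_nonneg)
  have dle: "d \<le> norm (x - s)" if "s \<in> S" for s
    using infdist_le[OF that, of x] by (simp add: d_def dist_norm)
  have "\<exists>s\<in>S. (norm (x - s))\<^sup>2 < d\<^sup>2 + e" if "e > 0" for e
  proof -
    have "d < sqrt (d\<^sup>2 + e)"
      using that d0 by (intro real_less_rsqrt) auto
    then have "\<exists>s\<in>S. dist x s < sqrt (d\<^sup>2 + e)"
      using ne cInf_less_iff[of "dist x ` S" "sqrt (d\<^sup>2 + e)"]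
      by (auto simp: d_def infdist_notempty bdd_below.I2[of _ 0])
    then obtain s where s: "s \<in> S" "dist x s < sqrt (d\<^sup>2 + e)" by blast
    then have "(dist x s)\<^sup>2 < (sqrt (d\<^sup>2 + e))\<^sup>2"
      by (intro power_strict_mono) auto
    with s that show ?thesis by (auto simp: dist_norm)
  qed
  then have "\<forall>n. \<exists>s\<in>S. (norm (x - s))\<^sup>2 < d\<^sup>2 + inverse (real (Suc n))"
    by simp
  then obtain s where s: "\<And>n. s n \<in> S" "\<And>n. (norm (x - s n))\<^sup>2 < d\<^sup>2 + inverse (real (Suc n))"
    by metis
  have par: "(norm (s m - s n))\<^sup>2 \<le> 2 * inverse (real (Suc m)) + 2 * inverse (real (Suc n))" for m n
  proof -
    have mid: "(1/2) *\<^sub>R (s m + s n) \<in> S"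
      using s(1) S(1) by (intro subspace_scale subspace_add)
    \<comment> \<open>The parallelogram law for \<open>x - s m\<close> and \<open>x - s n\<close>.
      The midpoint lies in \<open>S\<close>, so its distance to \<open>x\<close> is at least
      \<open>d\<close>.\<close>
    have "(norm (s m - s n))\<^sup>2 + 4 * (norm (x - (1/2) *\<^sub>R (s m + s n)))\<^sup>2
        = 2 * (norm (x - s m))\<^sup>2 + 2 * (norm (x - s n))\<^sup>2"
      unfolding power2_norm_eq_inner
      by (simp add: inner_simps inner_commute field_simps)
    moreover have "d\<^sup>2 \<le> (norm (x - (1/2) *\<^sub>R (s m + s n)))\<^sup>2"
      using dle[OF mid] d0 by (intro power_mono)
    ultimately show ?thesis using s(2)[of m] s(2)[of n] by linarith
  qed
  have "Cauchy s"
  proof (rule metric_CauchyI)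
    fix e :: real assume "e > 0"
    then obtain N where N: "inverse (real (Suc N)) < e\<^sup>2 / 4"
      using reals_Archimedean[of "e\<^sup>2 / 4"] by auto
    have "dist (s m) (s n) < e" if "m \<ge> N" "n \<ge> N" for m n
    proof -
      have "inverse (real (Suc m)) \<le> inverse (real (Suc N))" "inverse (real (Suc n)) \<le> inverse (real (Suc N))"
        using that by (auto intro!: le_imp_inverse_le)
      then have "(norm (s m - s n))\<^sup>2 < e\<^sup>2"
        using par[of m n] N by linarith
      then show ?thesis
        using \<open>e > 0\<close> by (simp add: dist_norm power2_less_imp_less)
    qed
    then show "\<exists>M. \<forall>m\<ge>M. \<forall>n\<ge>M. dist (s m) (s n) < e" by blast
  qed
  then obtain p where p: "s \<longlonglongrightarrow> p"
    using Cauchy_convergent_iff convergent_def by blast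
  have pS: "p \<in> S"
    using closed_sequentially[OF S(2) _ p] s(1) by blast
  have "(norm (x - p))\<^sup>2 \<le> d\<^sup>2 + 0"
  proof (rule LIMSEQ_le)
    show "(\<lambda>n. (norm (x - s n))\<^sup>2) \<longlonglongrightarrow> (norm (x - p))\<^sup>2"
      using p by (intro tendsto_intros)
    show "(\<lambda>n. d\<^sup>2 + inverse (real (Suc n))) \<longlonglongrightarrow> d\<^sup>2 + 0"
      by (intro tendsto_intros LIMSEQ_inverse_real_of_nat)
  qed (use s(2) less_imp_le in blast)
  then have pd: "(norm (x - p))\<^sup>2 \<le> d\<^sup>2" by simp
  have "inner t (x - p) = 0" if "t \<in> S" for t
  proof (cases "t = 0")
    case False
    \<comment> \<open>The value of \<open>c\<close> that minimizes the quadratic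
      \<open>norm (x - (p + c *\<^sub>R t))\<close> squared; there the drop is the square of
      \<open>inner t (x - p)\<close> over that of \<open>norm t\<close>, which minimality forces to
      vanish.\<close>
    define c where "c = inner t (x - p) / (norm t)\<^sup>2"
    have "p + c *\<^sub>R t \<in> S"
      using S(1) pS that by (intro subspace_scale subspace_add)
    from dle[OF this] have "d\<^sup>2 \<le> (norm (x - (p + c *\<^sub>R t)))\<^sup>2"
      using d0 by (intro power_mono)
    also have "\<dots> = (norm (x - p))\<^sup>2 - 2 * c * inner t (x - p) + c\<^sup>2 * (norm t)\<^sup>2"
      unfolding power2_norm_eq_inner
      by (simp add: inner_simps inner_commute power2_eq_square algebra_simps)
    also have "\<dots> = (norm (x - p))\<^sup>2 - (inner t (x - p))\<^sup>2 / (norm t)\<^sup>2"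
      using False by (simp add: c_def field_simps power2_eq_square)
    finally have "(inner t (x - p))\<^sup>2 / (norm t)\<^sup>2 \<le> 0" using pd by linarith
    then show ?thesis using False by (simp add: divide_le_0_iff)
  qed simp
  with pS that show thesis by blast
qed

lemma complex_orthogonal_projection_exists:
  fixes x :: "'a::complex_hilbert_space"
  assumes S: "closed_csubspace S"
  obtains p where "p \<in> S" "\<And>s. s \<in> S \<Longrightarrow> cinner s (x - p) = 0"
proof -
  have csub: "complex_vector.subspace S" and cl: "closed S"
    using S by (auto simp: closed_csubspace_def)
  obtain p where p: "p \<in> S" "\<And>s. s \<in> S \<Longrightarrow> inner s (x - p) = 0"
    using orthogonal_projection_exists[OF csubspace_imp_subspace[OF csub] cl] by blast
  have "cinner s (x - p) = 0" if "s \<in> S" for s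
  proof -
    \<comment> \<open>\<open>S\<close> is invariant under multiplication by \<open>\<i>\<close>, so
      real orthogonality to the rotated vector removes the imaginary part.\<close>
    have "inner (\<i> *\<^sub>C s) (x - p) = 0"
      using that csub p(2) by (simp add: complex_vector.subspace_def)
    then show ?thesis
      using p(2)[OF that] by (simp add: complex_eq_iff inner_eq_Re_cinner cinner_scaleC_left)
  qed
  with p(1) that show thesis by blast
qed

text \<open>The representing vector is a multiple of the component of \<open>A x\<^sub>0\<close>, where \<open>\<phi> x\<^sub>0 = 1\<close>,
  orthogonal to \<open>A (ker \<phi>)\<close>; the bound keeps \<open>A x\<^sub>0\<close> away from the closure of that space.\<close>

lemma riesz_representation_through_map:
  fixes A :: "'a::complex_vector \<Rightarrow> 'b::complex_hilbert_space" and \<phi> :: "'a \<Rightarrow> complex"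
  assumes G: "complex_vector.subspace G"
    and A_add: "\<And>x y. A (x + y) = A x + A y" and A_scale: "\<And>a x. A (a *\<^sub>C x) = a *\<^sub>C A x"
    and \<phi>_add: "\<And>x y. \<phi> (x + y) = \<phi> x + \<phi> y" and \<phi>_scale: "\<And>a x. \<phi> (a *\<^sub>C x) = a * \<phi> x"
    and bound: "\<And>x. x \<in> G \<Longrightarrow> cmod (\<phi> x) \<le> C * norm (A x)"
  obtains g where "\<And>x. x \<in> G \<Longrightarrow> \<phi> x = cinner (A x) g"
proof (cases "\<forall>x\<in>G. \<phi> x = 0")
  case True
  then show thesis using that[of 0] by simp
next
  case False
  note G' = G[unfolded complex_vector.subspace_def]
  obtain x1 where x1: "x1 \<in> G" "\<phi> x1 \<noteq> 0" using False by blast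
  define x0 where "x0 = (1 / \<phi> x1) *\<^sub>C x1"
  have x0: "x0 \<in> G" "\<phi> x0 = 1"
    using x1 G' by (auto simp: x0_def \<phi>_scale)
  have diff: "x + (- a) *\<^sub>C y \<in> G" if "x \<in> G" "y \<in> G" for x y a
    using that G' by blast
  define N where "N = A ` {x \<in> G. \<phi> x = 0}"
  have A0: "A 0 = 0" and \<phi>0: "\<phi> 0 = 0"
    using A_add[of 0 0] \<phi>_add[of 0 0] by simp_all
  have "complex_vector.subspace N"
    unfolding complex_vector.subspace_def
  proof (intro conjI ballI allI)
    show "0 \<in> N" using A0 \<phi>0 G' by (force simp: N_def image_iff)
    show "u + v \<in> N" if uv: "u \<in> N" "v \<in> N" for u v
    proof -
      obtain x y where "x \<in> G" "\<phi> x = 0" "u = A x" "y \<in> G" "\<phi> y = 0" "v = A y"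
        using uv by (auto simp: N_def)
      then show ?thesis
        unfolding N_def using G' by (intro image_eqI[of _ _ "x + y"]) (simp_all add: A_add \<phi>_add)
    qed
    show "c *\<^sub>C u \<in> N" if u: "u \<in> N" for u c
    proof -
      obtain x where "x \<in> G" "\<phi> x = 0" "u = A x"
        using u by (auto simp: N_def)
      then show ?thesis
        unfolding N_def using G' by (intro image_eqI[of _ _ "c *\<^sub>C x"]) (simp_all add: A_scale \<phi>_scale)
    qed
  qed
  then have "closed_csubspace (closure N)"
    by (simp add: closed_csubspace_def csubspace_closure)
  then obtain p where p: "p \<in> closure N" "\<And>s. s \<in> closure N \<Longrightarrow> cinner s (A x0 - p) = 0"
    using complex_orthogonal_projection_exists by blast
  define e where "e = A x0 - p"
  have "e \<noteq> 0"
  proof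
    assume "e = 0"
    then have "A x0 \<in> closure N" using p(1) by (simp add: e_def)
    \<comment> \<open>For \<open>n = A y\<close> with \<open>\<phi> y = 0\<close>, apply the bound
      at \<open>x0 - y\<close>, where \<open>\<phi>\<close> still has the value 1.\<close>
    moreover have "1 \<le> C * norm (A x0 - n)" if "n \<in> N" for n
    proof -
      obtain y where y: "y \<in> G" "\<phi> y = 0" "n = A y" using \<open>n \<in> N\<close> by (auto simp: N_def)
      have "A x0 = A (x0 - y) + A y" "\<phi> x0 = \<phi> (x0 - y) + \<phi> y"
        by (simp_all flip: A_add \<phi>_add)
      moreover have "x0 - y \<in> G"
        using G x0(1) y(1) by (rule complex_vector.subspace_diff)
      ultimately show ?thesis
        using bound[of "x0 - y"] x0(2) y by simp
    qed
    moreover have "C > 0"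
    proof (rule ccontr)
      assume "\<not> C > 0"
      then have "C * norm (A x0) \<le> 0" by (simp add: mult_nonpos_nonneg)
      then show False using bound[OF x0(1)] x0(2) by simp
    qed
    moreover from this obtain n where n: "n \<in> N" "dist n (A x0) < 1 / C"
      using \<open>A x0 \<in> closure N\<close> unfolding closure_approachable by (meson zero_less_divide_1_iff)
    ultimately have "1 \<le> C * norm (A x0 - n)" "C * norm (A x0 - n) < 1"
      by (auto simp: dist_norm norm_minus_commute field_simps)
    then show False by simp
  qed
  have "cinner (A x0) e = cinner e e"
    using p(2)[OF p(1)] cinner_add_left[of e p e] by (simp add: e_def)
  then have Ax0: "cinner (A x0) e = complex_of_real ((norm e)\<^sup>2)"
    by (simp add: cinner_self)
  show thesis
  proof (rule that[of "complex_of_real (1 / (norm e)\<^sup>2) *\<^sub>C e"])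
    fix x assume x: "x \<in> G"
    \<comment> \<open>Subtracting \<open>\<phi> x\<close> times \<open>x0\<close> leads into the
      kernel of \<open>\<phi>\<close>, whose image is orthogonal to \<open>e\<close>. This
      determines \<open>cinner (A x) e\<close> up to the normalization of \<open>e\<close>.\<close>
    have "A (x + (- \<phi> x) *\<^sub>C x0) \<in> N"
      using diff[OF x x0(1)] x0(2) by (simp add: N_def \<phi>_add \<phi>_scale del: complex_vector.scale_minus_left)
    then have "cinner (A (x + (- \<phi> x) *\<^sub>C x0)) e = 0"
      using p(2) closure_subset by (force simp: e_def)
    then have "cinner (A x) e = \<phi> x * complex_of_real ((norm e)\<^sup>2)"
      using Ax0 by (simp add: A_add A_scale cinner_add_left cinner_scaleC_left
          del: complex_vector.scale_minus_left)
    then show "\<phi> x = cinner (A x) (complex_of_real (1 / (norm e)\<^sup>2) *\<^sub>C e)"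
      using \<open>e \<noteq> 0\<close> by (simp add: cinner_scaleC_right)
  qed
qed

section \<open>The open mapping theorem\<close>

text \<open>The Baire half of the open mapping theorem: the closed range is a countable union of
  closures of images of balls, so one of them has interior relative to the range. Differences and
  scaling carry this to all right-hand sides, with an error small enough to iterate.\<close>

lemma almost_open_mapping:
  fixes A :: "'a::real_normed_vector \<Rightarrow> 'b::banach"
  assumes A: "linear A" and G: "subspace G" and R: "closed (A ` G)"
  obtains K where "0 \<le> K"
    "\<And>r. r \<in> A ` G \<Longrightarrow> \<exists>x\<in>G. norm x \<le> K * norm r \<and> norm (r - A x) \<le> norm r / 2"
proof -
  let ?R = "A ` G" and ?E = "\<lambda>n::nat. closure (A ` (G \<inter> cball 0 (real n)))"
  have subR: "subspace ?R" using A G by (rule linear_subspace_image)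
  have E_sub: "?E n \<subseteq> ?R" for n
    by (rule closure_minimal[OF _ R]) auto
  have "\<Union>(range ?E) = ?R"
  proof
    show "?R \<subseteq> \<Union>(range ?E)"
    proof
      fix r assume "r \<in> ?R"
      then obtain x where x: "x \<in> G" "r = A x" by auto
      obtain n where "norm x \<le> real n" using real_arch_simple by blast
      with x have "r \<in> A ` (G \<inter> cball 0 (real n))" by auto
      then have "r \<in> ?E n" by (rule subsetD[OF closure_subset])
      then show "r \<in> \<Union>(range ?E)" by (rule UN_I[OF UNIV_I])
    qed
  qed (use E_sub in auto)
  \<comment> \<open>A closed subset of a Banach space is completely metrizable, so Baire's theorem
    applies inside the range itself.\<close>
  moreover have "completely_metrizable_space (top_of_set ?R)"
    using R by (intro completely_metrizable_space_closedin[of euclidean])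
      (auto simp: completely_metrizable_space_euclidean)
  moreover have "top_of_set ?R interior_of ?R = ?R"
    by (metis interior_of_topspace topspace_euclidean_subtopology)
  moreover have "?R \<noteq> {}" using subspace_0[OF subR] by blast
  moreover have "closedin (top_of_set ?R) (?E n)" for n
    using E_sub by (auto intro: closed_subset)
  ultimately obtain n where "top_of_set ?R interior_of ?E n \<noteq> {}"
    using Baire_category_alt[of "top_of_set ?R" "range ?E"] by force
  then obtain r0 T where T: "openin (top_of_set ?R) T" "r0 \<in> T" "T \<subseteq> ?E n"
    by (auto simp: interior_of_def)
  then obtain e where e: "e > 0" "\<And>r. r \<in> ?R \<Longrightarrow> dist r r0 < e \<Longrightarrow> r \<in> T" and r0: "r0 \<in> ?R"
    unfolding openin_euclidean_subtopology_iff by blast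
  \<comment> \<open>Both \<open>r0 + r\<close> and \<open>r0\<close> lie in \<open>?E n\<close>;
    approximating each within \<open>e/8\<close> by images of vectors of norm at most
    \<open>n\<close> and subtracting gives \<open>2 * n\<close> and \<open>e/4\<close>.\<close>
  have small: "\<exists>x\<in>G. norm x \<le> 2 * n \<and> norm (r - A x) \<le> e/4" if r: "r \<in> ?R" "norm r < e" for r
  proof -
    have "r0 + r \<in> ?E n" "r0 \<in> ?E n"
      using e(2)[of "r0 + r"] r subspace_add[OF subR r0 r(1)] T by (auto simp: dist_norm)
    then have near: "\<exists>u\<in>A ` (G \<inter> cball 0 n). dist u (r0 + r) < e/8"
      "\<exists>u\<in>A ` (G \<inter> cball 0 n). dist u r0 < e/8"
      using \<open>e > 0\<close> unfolding closure_approachable by (meson divide_pos_pos zero_less_numeral)+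
    from near(1) obtain x where x: "x \<in> G" "norm x \<le> n" "dist (A x) (r0 + r) < e/8"
      by auto
    from near(2) obtain y where y: "y \<in> G" "norm y \<le> n" "dist (A y) r0 < e/8"
      by auto
    have "r - A (x - y) = (r0 + r - A x) - (r0 - A y)"
      by (simp add: linear_diff[OF A])
    then have "norm (r - A (x - y)) \<le> norm (r0 + r - A x) + norm (r0 - A y)"
      by (metis norm_triangle_ineq4)
    then have "norm (r - A (x - y)) \<le> e/4"
      using x(3) y(3) by (simp add: dist_norm norm_minus_commute)
    moreover have "norm (x - y) \<le> 2 * n"
      using norm_triangle_ineq4[of x y] x(2) y(2) by linarith
    ultimately show ?thesis using subspace_diff[OF G x(1) y(1)] by blast
  qed
  show thesis
  proof (rule that[of "4 * n / e"])
    fix r assume r: "r \<in> ?R"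
    show "\<exists>x\<in>G. norm x \<le> (4 * n / e) * norm r \<and> norm (r - A x) \<le> norm r / 2"
    proof (cases "r = 0")
      case True
      then show ?thesis using subspace_0[OF G] linear_0[OF A] by (intro bexI[of _ 0]) auto
    next
      case False
      \<comment> \<open>Rescales \<open>r\<close> to norm \<open>e/2\<close>, inside the ball where
        \<open>small\<close> applies. Scaling back turns the error \<open>e/4\<close> into
        \<open>norm r / 2\<close> and the bound \<open>2 * n\<close> into
        \<open>4 * n / e * norm r\<close>.\<close>
      define c where "c = e / (2 * norm r)"
      have c: "c > 0" using False e(1) by (simp add: c_def)
      have "c *\<^sub>R r \<in> ?R" using subspace_scale[OF subR r] .
      moreover have "norm (c *\<^sub>R r) < e" using False e(1) by (simp add: c_def)
      ultimately obtain x where x: "x \<in> G" "norm x \<le> 2 * n" "norm (c *\<^sub>R r - A x) \<le> e/4"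
        using small by blast
      let ?x = "inverse c *\<^sub>R x"
      have "r - A ?x = inverse c *\<^sub>R (c *\<^sub>R r - A x)"
        using c by (simp add: linear_scale[OF A] scaleR_diff_right)
      then have "norm (r - A ?x) = inverse c * norm (c *\<^sub>R r - A x)"
        using c by simp
      also have "\<dots> \<le> inverse c * (e/4)"
        using c x(3) by (intro mult_left_mono) auto
      also have "\<dots> = norm r / 2" using e(1) by (simp add: c_def)
      finally have "norm (r - A ?x) \<le> norm r / 2" .
      moreover have "norm ?x \<le> inverse c * (2 * n)"
        using c x(2) by (simp add: mult_left_mono)
      then have "norm ?x \<le> 4 * n / e * norm r" by (simp add: c_def algebra_simps)
      ultimately show ?thesis using subspace_scale[OF G x(1)] by blast
    qed
  qed (use e(1) in simp)
qed

text \<open>Approximate solving is repeated on the residual, which at least halves in norm each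
  time; completeness sums the corrections to an exact preimage, and the geometric series doubles the
  constant.\<close>

lemma open_mapping_bound:
  fixes A :: "'a::banach \<Rightarrow> 'b::banach"
  assumes A: "bounded_linear A" and G: "subspace G" "closed G" and R: "closed (A ` G)"
  obtains K where "\<And>r. r \<in> A ` G \<Longrightarrow> \<exists>x\<in>G. A x = r \<and> norm x \<le> K * norm r"
proof -
  note lin = bounded_linear.linear[OF A]
  obtain K where K: "0 \<le> K"
    "\<And>r. r \<in> A ` G \<Longrightarrow> \<exists>x\<in>G. norm x \<le> K * norm r \<and> norm (r - A x) \<le> norm r / 2"
    using almost_open_mapping[OF lin G(1) R] by blast
  then obtain h where h: "\<And>r. r \<in> A ` G \<Longrightarrow> h r \<in> G"
    "\<And>r. r \<in> A ` G \<Longrightarrow> norm (h r) \<le> K * norm r"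
    "\<And>r. r \<in> A ` G \<Longrightarrow> norm (r - A (h r)) \<le> norm r / 2"
    by metis
  show thesis
  proof (rule that[of "2 * K"])
    fix r assume r: "r \<in> A ` G"
    \<comment> \<open>\<open>\<rho> k\<close> is the residual after \<open>k\<close> corrections,
      and \<open>h (\<rho> k)\<close> is the next correction.\<close>
    define \<rho> where "\<rho> k = ((\<lambda>r. r - A (h r)) ^^ k) r" for k
    have \<rho>_Suc: "\<rho> (Suc k) = \<rho> k - A (h (\<rho> k))" for k by (simp add: \<rho>_def)
    have \<rho>: "\<rho> k \<in> A ` G \<and> norm (\<rho> k) \<le> norm r * (1/2)^k" for k
    proof (induction k)
      case 0
      then show ?case using r by (simp add: \<rho>_def)
    next
      case (Suc k)
      then have "\<rho> (Suc k) \<in> A ` G"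
        unfolding \<rho>_Suc using h(1)
        by (intro subspace_diff[OF linear_subspace_image[OF lin G(1)]]) auto
      moreover have "norm (\<rho> (Suc k)) \<le> norm r * (1/2) ^ Suc k"
        using h(3)[of "\<rho> k"] Suc by (simp add: \<rho>_Suc)
      ultimately show ?case ..
    qed
    have nh: "norm (h (\<rho> k)) \<le> K * norm r * (1/2)^k" for k
    proof -
      have "norm (h (\<rho> k)) \<le> K * norm (\<rho> k)"
        using h(2) \<rho> by blast
      also have "\<dots> \<le> K * (norm r * (1/2)^k)"
        using \<rho> K(1) by (intro mult_left_mono) auto
      finally show ?thesis by (simp only: mult.assoc)
    qed
    have geo: "(\<lambda>k. K * norm r * (1/2)^k) sums (2 * K * norm r)"
      using sums_mult[OF geometric_sums[of "1/2::real"], of "K * norm r"] by (simp add: mult_ac)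
    have sm: "summable (\<lambda>k. h (\<rho> k))"
      by (rule summable_comparison_test'[OF sums_summable[OF geo] nh])
    have "(\<Sum>k. h (\<rho> k)) \<in> G"
    proof (rule closed_sequentially[OF G(2) _ summable_LIMSEQ[OF sm]])
      show "(\<Sum>k<n. h (\<rho> k)) \<in> G" for n
        using \<rho> h(1) by (intro subspace_sum[OF G(1)]) blast
    qed
    moreover have "norm (\<Sum>k. h (\<rho> k)) \<le> 2 * K * norm r"
      using norm_suminf_le[OF nh sums_summable[OF geo]] sums_unique[OF geo] by simp
    moreover have "A (\<Sum>k. h (\<rho> k)) = r"
    proof -
      have "(\<lambda>k. norm r * (1/2)^k) \<longlonglongrightarrow> norm r * 0"
        by (intro tendsto_intros LIMSEQ_realpow_zero) auto
      then have "\<rho> \<longlonglongrightarrow> 0"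
        using \<rho> by (intro Lim_null_comparison[of \<rho>]) auto
      \<comment> \<open>\<open>A (h (\<rho> k))\<close> is the difference of consecutive residuals,
        so the series telescopes to the initial residual \<open>r\<close>.\<close>
      from telescope_sums'[OF this] have "(\<lambda>k. A (h (\<rho> k))) sums \<rho> 0"
        by (simp add: \<rho>_Suc)
      moreover have "\<rho> 0 = r" by (simp add: \<rho>_def)
      ultimately show ?thesis
        using bounded_linear.suminf[OF A sm] by (simp add: sums_iff)
    qed
    ultimately show "\<exists>x\<in>G. A x = r \<and> norm x \<le> 2 * K * norm r" by blast
  qed
qed

text \<open>Makes \<open>open_mapping_bound\<close> available for Hilbert spaces and their
  products.\<close>

instance complex_hilbert_space \<subseteq> banach ..

section \<open>Fundamental symmetries and boundary relations\<close>

lemma cinner_eq_imp_eq: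
  assumes "\<And>u. cinner u x = cinner u (y::'a::complex_inner)"
  shows "x = y"
  using assms[of "x - y"] cinner_self[of "x - y"] by (simp add: cinner_diff_right)

lemma fundamental_symmetry_involution:
  assumes "fundamental_symmetry J"
  shows "J (J x) = x"
proof -
  have "(x, J x) \<in> (graph_of J)\<inverse>"
    using assms by (auto simp: fundamental_symmetry_def graph_of_def)
  then show ?thesis by (auto simp: graph_of_def)
qed

lemma fundamental_symmetry_selfadjoint:
  assumes "fundamental_symmetry J"
  shows "cinner (J x) y = cinner x (J y)"
proof -
  have "(y, J y) \<in> hilbert_adjoint (graph_of J)"
    using assms by (auto simp: fundamental_symmetry_def graph_of_def)
  then show ?thesis by (auto simp: hilbert_adjoint_def graph_of_def)
qed

text \<open>Self-adjointness moves \<open>J\<close> to the other argument, where the scalar can be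
  pulled out; testing against all vectors gives the equality.\<close>

lemma fundamental_symmetry_scaleC:
  assumes "fundamental_symmetry J"
  shows "J (a *\<^sub>C x) = a *\<^sub>C J x"
  by (rule cinner_eq_imp_eq)
    (simp add: fundamental_symmetry_selfadjoint[OF assms, symmetric] cinner_scaleC_right)

text \<open>Lets the facts about \<open>Jhat J\<close> serve on the boundary side too, where the
  symmetry is \<open>Jhat id\<close>.\<close>

lemma fundamental_symmetry_id: "fundamental_symmetry (id :: 'a::complex_inner \<Rightarrow> 'a)"
  by (auto simp: fundamental_symmetry_def hilbert_adjoint_def graph_of_def intro: cinner_eq_imp_eq)

section \<open>Green's identity and the relation \<open>\<Gamma>\<^sub>#\<close>\<close>

lemma cinner_Jhat_right:
  "cinner (f, f') (Jhat J (g, g')) = \<i> * (cinner f (J g') - cinner f' (J g))"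
  by (simp add: Jhat_def cinner_prod_def cinner_scaleC_right algebra_simps
      del: complex_vector.scale_minus_left)

lemma Jhat_selfadjoint:
  assumes "fundamental_symmetry J"
  shows "cinner (Jhat J p) q = cinner p (Jhat J q)"
  by (cases p; cases q)
    (simp add: Jhat_def cinner_prod_def cinner_scaleC_left cinner_scaleC_right
      fundamental_symmetry_selfadjoint[OF assms] del: complex_vector.scale_minus_left)

lemma Jhat_involution:
  assumes "fundamental_symmetry J"
  shows "Jhat J (Jhat J p) = p"
  by (cases p)
    (simp add: Jhat_def fundamental_symmetry_scaleC[OF assms] scaleC_scaleC scaleC_one
      fundamental_symmetry_involution[OF assms] del: complex_vector.scale_minus_left)

text \<open>\<open>Jhat J\<close> is an involution, so the intermediate element of the composition
  can only be \<open>Jhat J k\<close>.\<close>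

lemma mem_boundary_sharp_iff:
  assumes "fundamental_symmetry J"
  shows "(k, l) \<in> boundary_sharp J \<Gamma> \<longleftrightarrow>
    (\<forall>(u, v)\<in>\<Gamma>. cinner v (Jhat id l) = cinner u (Jhat J k))"
proof -
  have "(k, l) \<in> boundary_sharp J \<Gamma> \<longleftrightarrow> (\<exists>x. (Jhat id l, x) \<in> hilbert_adjoint \<Gamma> \<and> k = Jhat J x)"
    unfolding boundary_sharp_def boundary_adjoint_def graph_of_def by blast
  also have "\<dots> \<longleftrightarrow> (Jhat id l, Jhat J k) \<in> hilbert_adjoint \<Gamma>"
    using Jhat_involution[OF assms] by metis
  finally show ?thesis by (simp add: hilbert_adjoint_def)
qed

text \<open>The abstract Green identity; the factor \<open>\<i>\<close> from
  \<open>cinner_Jhat_right\<close> occurs on both sides and cancels.\<close>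

lemma mem_boundary_sharp_iff_coords:
  assumes "fundamental_symmetry J"
  shows "((g, g'), (m, m')) \<in> boundary_sharp J \<Gamma> \<longleftrightarrow>
    (\<forall>((f, f'), (h, h'))\<in>\<Gamma>. cinner h m' - cinner h' m = cinner f (J g') - cinner f' (J g))"
  by (auto simp: mem_boundary_sharp_iff[OF assms] cinner_Jhat_right)

section \<open>Closedness of adjoints and the double adjoint\<close>

lemma closed_csubspace_orthogonal: "closed_csubspace {x::'a::complex_inner. \<forall>s\<in>S. cinner s x = 0}"
proof -
  have "closed {x::'a. cinner s x = 0}" for s
    by (intro closed_Collect_eq continuous_on_cinner_right continuous_on_const)
  then have "closed (\<Inter>s\<in>S. {x::'a. cinner s x = 0})" by blast
  moreover have "{x::'a. \<forall>s\<in>S. cinner s x = 0} = (\<Inter>s\<in>S. {x. cinner s x = 0})" by blast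
  ultimately show ?thesis
    by (auto simp: closed_csubspace_def complex_vector.subspace_def cinner_add_right cinner_scaleC_right)
qed

text \<open>The adjoint is the orthogonal complement of the rotated set of pairs
  \<open>(v, - u)\<close> with \<open>(u, v) \<in> R\<close>.\<close>

lemma closed_csubspace_hilbert_adjoint: "closed_csubspace (hilbert_adjoint R)"
proof -
  have "hilbert_adjoint R = {x. \<forall>s\<in>(\<lambda>w. (snd w, - fst w)) ` R. cinner s x = 0}"
    by (simp add: hilbert_adjoint_def case_prod_beta' cinner_Pair_left cinner_minus_left)
  then show ?thesis by (simp only: closed_csubspace_orthogonal)
qed

lemma closed_csubspace_boundary_sharp:
  assumes "fundamental_symmetry J"
  shows "closed_csubspace (boundary_sharp J \<Gamma>)"
proof -
  have "x \<in> boundary_sharp J \<Gamma> \<longleftrightarrow>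
      (\<forall>s\<in>(\<lambda>w. (- Jhat J (fst w), Jhat id (snd w))) ` \<Gamma>. cinner s x = 0)" for x
    using mem_boundary_sharp_iff[OF assms, of "fst x" "snd x" \<Gamma>]
    by (simp add: case_prod_beta cinner_Pair_left cinner_minus_left
        Jhat_selfadjoint[OF assms] Jhat_selfadjoint[OF fundamental_symmetry_id])
  then have "boundary_sharp J \<Gamma> =
      {x. \<forall>s\<in>(\<lambda>w. (- Jhat J (fst w), Jhat id (snd w))) ` \<Gamma>. cinner s x = 0}"
    by blast
  then show ?thesis by (simp only: closed_csubspace_orthogonal)
qed

text \<open>Membership of a fixed \<open>(k, l)\<close> says that the relation lies in the kernel of
  one continuous functional; this kernel is closed, so it contains \<open>\<Gamma>\<close> exactly
  if it contains the closure.\<close>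

lemma boundary_sharp_closure:
  assumes "fundamental_symmetry J"
  shows "boundary_sharp J (closure \<Gamma>) = boundary_sharp J \<Gamma>"
proof -
  have "\<Gamma> \<subseteq> {x. cinner x (- k, l) = 0} \<longleftrightarrow> closure \<Gamma> \<subseteq> {x. cinner x (- k, l) = 0}" for k l
  proof -
    have "closed {x. cinner x (- k, l) = 0}"
      by (intro closed_Collect_eq continuous_on_cinner_left continuous_on_const)
    then show ?thesis by (meson closure_minimal closure_subset subset_trans)
  qed
  moreover have "(k, l) \<in> boundary_sharp J R \<longleftrightarrow> R \<subseteq> {x. cinner x (- Jhat J k, Jhat id l) = 0}" for k l R
    by (simp add: mem_boundary_sharp_iff[OF assms] subset_iff Ball_def case_prod_beta
        cinner_Pair_right cinner_minus_right del: split_paired_All)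
  ultimately show ?thesis by (metis subsetI subset_antisym surj_pair)
qed

text \<open>One inclusion is the symmetry of the defining condition. For the other, project
  \<open>x\<close> onto \<open>\<Gamma>\<close>: the residual, twisted by the two symmetries, lies
  in \<open>boundary_sharp J \<Gamma>\<close>, and pairing it with \<open>x\<close> forces the
  residual to be zero.\<close>

lemma boundary_sharp_boundary_sharp:
  fixes J :: "'h::complex_hilbert_space \<Rightarrow> 'h"
    and \<Gamma> :: "(('h \<times> 'h) \<times> ('l::complex_hilbert_space \<times> 'l)) set"
  assumes J: "fundamental_symmetry J" and \<Gamma>: "closed_csubspace \<Gamma>"
  shows "boundary_sharp J (boundary_sharp J \<Gamma>) = \<Gamma>"
proof
  note sa = Jhat_selfadjoint[OF J] Jhat_selfadjoint[OF fundamental_symmetry_id]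
  show "\<Gamma> \<subseteq> boundary_sharp J (boundary_sharp J \<Gamma>)"
  proof clarify
    fix f f' h h' assume *: "((f, f'), (h, h')) \<in> \<Gamma>"
    have "cinner v (Jhat id (h, h')) = cinner u (Jhat J (f, f'))" if "(u, v) \<in> boundary_sharp J \<Gamma>" for u v
    proof -
      have "cinner (h, h') (Jhat id v) = cinner (f, f') (Jhat J u)"
        using that * by (auto simp: mem_boundary_sharp_iff[OF J])
      then show ?thesis by (metis sa cinner_commute)
    qed
    then show "((f, f'), (h, h')) \<in> boundary_sharp J (boundary_sharp J \<Gamma>)"
      by (auto simp: mem_boundary_sharp_iff[OF J])
  qed
  show "boundary_sharp J (boundary_sharp J \<Gamma>) \<subseteq> \<Gamma>"
  proof
    fix x assume x: "x \<in> boundary_sharp J (boundary_sharp J \<Gamma>)"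
    obtain p where p: "p \<in> \<Gamma>" "\<And>s. s \<in> \<Gamma> \<Longrightarrow> cinner s (x - p) = 0"
      using complex_orthogonal_projection_exists[OF \<Gamma>] by blast
    obtain a b where ab: "x - p = (a, b)" by (cases "x - p")
    \<comment> \<open>The minus sign on the boundary component turns orthogonality, where two terms
      add up to zero, into the equality of two terms that defines
      \<open>boundary_sharp\<close>.\<close>
    have "cinner v (Jhat id (- Jhat id b)) = cinner u (Jhat J (Jhat J a))" if "(u, v) \<in> \<Gamma>" for u v
    proof -
      have "cinner u a + cinner v b = 0"
        using p(2)[OF that] by (simp add: ab cinner_prod_def)
      moreover have "cinner v (Jhat id (- Jhat id b)) = - cinner v b"
        by (simp only: sa[symmetric] cinner_minus_right)
          (simp only: sa Jhat_involution[OF fundamental_symmetry_id])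
      ultimately show ?thesis
        by (metis Jhat_involution[OF J] eq_neg_iff_add_eq_0)
    qed
    then have "(Jhat J a, - Jhat id b) \<in> boundary_sharp J \<Gamma>"
      unfolding mem_boundary_sharp_iff[OF J] by blast
    then have "cinner (- Jhat id b) (Jhat id (snd x)) = cinner (Jhat J a) (Jhat J (fst x))"
      using x mem_boundary_sharp_iff[OF J, of "fst x" "snd x" "boundary_sharp J \<Gamma>"] by auto
    then have eq: "cinner a (fst x) = - cinner b (snd x)"
      by (simp add: cinner_minus_left sa Jhat_involution[OF J]
          Jhat_involution[OF fundamental_symmetry_id])
    \<comment> \<open>The residual is orthogonal to \<open>x\<close> and to \<open>p\<close>, hence
      to itself.\<close>
    then have "cinner (x - p) x = 0"
      by (simp add: ab cinner_Pair_left eq)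
    moreover have "cinner (x - p) p = 0"
      using p by (metis cinner_commute complex_cnj_zero)
    ultimately have "cinner (x - p) (x - p) = 0"
      by (simp only: cinner_diff_right[of "x - p" x p]) simp
    then show "x \<in> \<Gamma>" using p(1) by (simp add: cinner_self)
  qed
qed

section \<open>Weyl families\<close>

lemma mem_weyl_family_iff: "l \<in> weyl_family \<Gamma> z \<longleftrightarrow> (\<exists>f. ((f, z *\<^sub>C f), l) \<in> \<Gamma>)"
  by (auto simp: weyl_family_def rel_scalar_def graph_of_def)

text \<open>Stated for an arbitrary closed linear \<open>\<Gamma>\<close>, so that it serves for the
  closure of a boundary relation at \<open>z\<close> and for its \<open>boundary_sharp\<close> at
  \<open>cnj z\<close>.\<close>

lemma hilbert_adjoint_weyl_family:
  fixes J :: "'h::complex_hilbert_space \<Rightarrow> 'h"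
    and \<Gamma> :: "(('h \<times> 'h) \<times> ('l::complex_hilbert_space \<times> 'l)) set"
  assumes J: "fundamental_symmetry J" and \<Gamma>: "closed_csubspace \<Gamma>"
    and ran: "closed (Range (rel_shift (Domain \<Gamma>) z))"
  shows "hilbert_adjoint (weyl_family \<Gamma> z) = weyl_family (boundary_sharp J \<Gamma>) (cnj z)"
proof -
  \<comment> \<open>With second component \<open>cnj z *\<^sub>C g\<close>, the two interior terms
    of Green's identity combine into one inner product with
    \<open>f' - z *\<^sub>C f\<close>.\<close>
  have sharp: "((g, cnj z *\<^sub>C g), (m, m')) \<in> boundary_sharp J \<Gamma> \<longleftrightarrow>
    (\<forall>((f, f'), (h, h'))\<in>\<Gamma>. cinner h' m - cinner h m' = cinner (f' - z *\<^sub>C f) (J g))" for g m m'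
  proof -
    have "cinner h m' - cinner h' m = cinner f (J (cnj z *\<^sub>C g)) - cinner f' (J g) \<longleftrightarrow>
        cinner h' m - cinner h m' = cinner (f' - z *\<^sub>C f) (J g)" for f f' h h'
      by (auto simp: fundamental_symmetry_scaleC[OF J] cinner_scaleC_right cinner_scaleC_left
          cinner_diff_left algebra_simps)
    then show ?thesis
      by (simp only: mem_boundary_sharp_iff_coords[OF J])
  qed
  show ?thesis
  proof (intro set_eqI iffI; clarify)
    fix m m' assume "(m, m') \<in> weyl_family (boundary_sharp J \<Gamma>) (cnj z)"
    then obtain g where "((g, cnj z *\<^sub>C g), (m, m')) \<in> boundary_sharp J \<Gamma>"
      by (auto simp: mem_weyl_family_iff)
    then have g: "cinner h' m - cinner h m' = cinner (f' - z *\<^sub>C f) (J g)"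
      if "((f, f'), (h, h')) \<in> \<Gamma>" for f f' h h'
      using that unfolding sharp by blast
    \<comment> \<open>Elements of the Weyl family come from \<open>f' = z *\<^sub>C f\<close>, where
      the right-hand side of \<open>g\<close> vanishes.\<close>
    show "(m, m') \<in> hilbert_adjoint (weyl_family \<Gamma> z)"
      using g by (fastforce simp: hilbert_adjoint_def mem_weyl_family_iff)
  next
    fix m m' assume adj: "(m, m') \<in> hilbert_adjoint (weyl_family \<Gamma> z)"
    define A :: "('h \<times> 'h) \<times> ('l \<times> 'l) \<Rightarrow> 'h" where "A p = snd (fst p) - z *\<^sub>C fst (fst p)" for p
    define \<phi> :: "('h \<times> 'h) \<times> ('l \<times> 'l) \<Rightarrow> complex"
      where "\<phi> p = cinner (snd (snd p)) m - cinner (fst (snd p)) m'" for p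
    have csub: "complex_vector.subspace \<Gamma>" and cl: "closed \<Gamma>"
      using \<Gamma> by (auto simp: closed_csubspace_def)
    have A_add: "A (p + q) = A p + A q" and \<phi>_add: "\<phi> (p + q) = \<phi> p + \<phi> q" for p q
      by (simp_all add: A_def \<phi>_def scaleC_add_right cinner_add_left)
    have A_scale: "A (a *\<^sub>C p) = a *\<^sub>C A p" and \<phi>_scale: "\<phi> (a *\<^sub>C p) = a * \<phi> p" for p a
      by (simp_all add: A_def \<phi>_def scaleC_prod_def complex_vector.scale_right_diff_distrib
          cinner_scaleC_left right_diff_distrib mult.commute)
    have "bounded_linear A"
      unfolding A_def
      by (intro bounded_linear_sub bounded_linear_compose[OF bounded_linear_scaleC]
          bounded_linear_compose[OF bounded_linear_fst] bounded_linear_compose[OF bounded_linear_snd]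
          bounded_linear_fst bounded_linear_snd)
    moreover have "A ` \<Gamma> = Range (rel_shift (Domain \<Gamma>) z)"
      by (force simp: A_def rel_shift_def image_iff)
    ultimately obtain K where K: "\<And>r. r \<in> A ` \<Gamma> \<Longrightarrow> \<exists>p\<in>\<Gamma>. A p = r \<and> norm p \<le> K * norm r"
      using open_mapping_bound[of A \<Gamma>] csubspace_imp_subspace[OF csub] cl ran by metis
    have "bounded_linear \<phi>"
      unfolding \<phi>_def
      by (intro bounded_linear_sub bounded_linear_compose[OF bounded_linear_cinner_left]
          bounded_linear_compose[OF bounded_linear_fst] bounded_linear_compose[OF bounded_linear_snd]
          bounded_linear_snd)
    then obtain C where C: "0 \<le> C" "\<And>p. cmod (\<phi> p) \<le> C * norm p"
      using bounded_linear.nonneg_bounded by (metis mult.commute)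
    have ker: "\<phi> p = 0" if "p \<in> \<Gamma>" "A p = 0" for p
    proof -
      obtain f f' h h' where p: "p = ((f, f'), (h, h'))" by (metis surj_pair)
      then have "(h, h') \<in> weyl_family \<Gamma> z"
        using that by (auto simp: mem_weyl_family_iff A_def)
      then show ?thesis using adj by (auto simp: hilbert_adjoint_def \<phi>_def p)
    qed
    \<comment> \<open>Replace \<open>p\<close> by a preimage \<open>q\<close> of \<open>A p\<close>
      of controlled norm; \<open>p - q\<close> lies in the kernel of \<open>A\<close>, so
      \<open>\<phi>\<close> does not see the change.\<close>
    have "cmod (\<phi> p) \<le> C * K * norm (A p)" if p: "p \<in> \<Gamma>" for p
    proof -
      obtain q where q: "q \<in> \<Gamma>" "A q = A p" "norm q \<le> K * norm (A p)"
        using K p by blast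
      have "p - q \<in> \<Gamma>"
        using csub p q(1) by (rule complex_vector.subspace_diff)
      moreover have "A (p - q) = 0"
        using A_add[of "p - q" q] q(2) by simp
      ultimately have "\<phi> p = \<phi> q"
        using ker[of "p - q"] \<phi>_add[of "p - q" q] by simp
      also have "cmod (\<phi> q) \<le> C * (K * norm (A p))"
        using C(2)[of q] mult_left_mono[OF q(3) C(1)] by linarith
      finally show ?thesis by (simp add: mult.assoc)
    qed
    then obtain g where g: "\<And>p. p \<in> \<Gamma> \<Longrightarrow> \<phi> p = cinner (A p) g"
      using riesz_representation_through_map[OF csub A_add A_scale \<phi>_add \<phi>_scale] by metis
    \<comment> \<open>The criterion \<open>sharp\<close> applies \<open>J\<close> to the interior
      vector, so the witness is \<open>J g\<close>, with \<open>J (J g) = g\<close> the Riesz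
      vector.\<close>
    have "((J g, cnj z *\<^sub>C J g), (m, m')) \<in> boundary_sharp J \<Gamma>"
      unfolding sharp using g by (fastforce simp: A_def \<phi>_def fundamental_symmetry_involution[OF J])
    then show "(m, m') \<in> weyl_family (boundary_sharp J \<Gamma>) (cnj z)"
      unfolding mem_weyl_family_iff by blast
  qed
qed

theorem theorem4p1:
  fixes  J :: "'h::complex_hilbert_space \<Rightarrow> 'h"
    and T :: "('h \<times> 'h) set"
    and \<Gamma> :: "(('h \<times> 'h) \<times> ('l::complex_hilbert_space \<times> 'l)) set"
  assumes "fundamental_symmetry J"
    and "closed_csubspace T" and "krein_symmetric J T"
    and "isometric_boundary_pair J T \<Gamma>"
  shows "\<forall>z. z \<notin> \<real> \<and>
      closed_csubspace (Range (rel_shift (Domain (closure \<Gamma>)) z)) \<longrightarrow>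
      hilbert_adjoint (weyl_family (closure \<Gamma>) z) = weyl_family (boundary_sharp J \<Gamma>) (cnj z) \<and>
      (closed_csubspace (Range (rel_shift (Domain (boundary_sharp J \<Gamma>)) (cnj z))) \<longrightarrow>
        closed_csubspace (weyl_family (closure \<Gamma>) z))"
proof (intro allI impI conjI)
  let ?\<Gamma> = "closure \<Gamma>"
  note J = assms(1)
  have closure: "closed_csubspace ?\<Gamma>"
    using assms(4) by (simp add: isometric_boundary_pair_def isometric_relation_def
        closed_csubspace_def csubspace_closure)
  fix z
  assume "z \<notin> \<real> \<and> closed_csubspace (Range (rel_shift (Domain ?\<Gamma>) z))"
  then show "hilbert_adjoint (weyl_family ?\<Gamma> z) = weyl_family (boundary_sharp J \<Gamma>) (cnj z)"
    using hilbert_adjoint_weyl_family[OF J closure] boundary_sharp_closure[OF J]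
    by (metis closed_csubspace_def)
  assume "closed_csubspace (Range (rel_shift (Domain (boundary_sharp J \<Gamma>)) (cnj z)))"
  \<comment> \<open>Using \<open>boundary_sharp\<close> twice returns the closure of
    \<open>\<Gamma>\<close>, and conjugating twice returns \<open>z\<close>; the Weyl family is
    thereby itself an adjoint.\<close>
  then have "hilbert_adjoint (weyl_family (boundary_sharp J \<Gamma>) (cnj z)) = weyl_family ?\<Gamma> z"
    using hilbert_adjoint_weyl_family[OF J closed_csubspace_boundary_sharp[OF J], of \<Gamma> "cnj z"]
      boundary_sharp_boundary_sharp[OF J closure] boundary_sharp_closure[OF J, of \<Gamma>]
    by (simp add: closed_csubspace_def)
  then show "closed_csubspace (weyl_family ?\<Gamma> z)"
    by (metis closed_csubspace_hilbert_adjoint)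
qed

end
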